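(* Let $\Omega\subset\mathbb{C}^n$ ($n\ge2$) be a bounded $m$-convex domain. Then there exists a constant $C>0$ such that $$d_K(x,y)\ge\log\left(\frac{L([x,y])^m+\delta(x)\vee\delta(y)}{\sqrt{\delta(x)\delta(y)}}\right)-C$$ for any $x,y\in\Omega$, where $[x,y]$ denotes a Kobayashi geodesic connecting $x$ and $y$ and $L([x,y])$ is its Euclidean length.
   Context: $\delta(x)=\delta_\Omega(x)=\inf\{|x-\xi|:\xi\in\partial\Omega\}$ and, for $v\in\mathbb{C}^n\setminus\{0\}$, $\delta_\Omega(x;v)=\inf\{|x-\xi|:\xi\in\partial\Omega\cap(x+\mathbb{C}v)\}$; $a\vee b=\max\{a,b\}$. A bounded convex domain $\Omega\subset\mathbb{C}^n$, $n\ge2$, is $m$-convex ($m>1$) if for some $C>0$, $\delta_\Omega(z;v)\le C\,\delta_\Omega(z)^{1/m}$ for all $z\in\Omega$ and all nonzero $v\in\mathbb{C}^n$. Kobayashi metric: $K_\Omega(x;v)=\inf\{|\xi|: f:\mathbb{D}\to\Omega \text{ holomorphic}, f(0)=x, df_0(\xi)=v\}$, with $\mathbb{D}$ the unit disc; the Kobayashi distance $d_K(x,y)$ is the infimum of $\int_0^1K_\Omega(\gamma(t);\dot\gamma(t))\,dt$ over piecewise $C^1$ curves $\gamma:[0,1]\to\Omega$ from $x$ to $y$. A Kobayashi geodesic connecting $x$ and $y$ is the image of an isometric embedding $[0,d_K(x,y)]\to(\Omega,d_K)$ sending endpoints to $x$ and $y$. *)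

theory Defs
  imports "HOL-Complex_Analysis.Complex_Analysis"
begin

definition bdry_dist :: "(complex ^ 'n) set \<Rightarrow> complex ^ 'n \<Rightarrow> real" where
  "bdry_dist \<Omega> x = infdist x (frontier \<Omega>)"

definition complex_line :: "complex ^ 'n \<Rightarrow> complex ^ 'n \<Rightarrow> (complex ^ 'n) set" where
  "complex_line x v = {x + c *s v | c. True}"

definition bdry_dist_dir :: "(complex ^ 'n) set \<Rightarrow> complex ^ 'n \<Rightarrow> complex ^ 'n \<Rightarrow> real" where
  "bdry_dist_dir \<Omega> x v = infdist x (frontier \<Omega> \<inter> complex_line x v)"

definition bounded_convex_domain :: "(complex ^ 'n) set \<Rightarrow> bool" where
  "bounded_convex_domain \<Omega> \<longleftrightarrow>
     open \<Omega> \<and> connected \<Omega> \<and> \<Omega> \<noteq> {} \<and> bounded \<Omega> \<and> convex \<Omega>"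

definition m_convex :: "real \<Rightarrow> (complex ^ 'n) set \<Rightarrow> bool" where
  "m_convex m \<Omega> \<longleftrightarrow>
     bounded_convex_domain \<Omega> \<and> m > 1 \<and>
     (\<exists>C>0. \<forall>z\<in>\<Omega>. \<forall>v. v \<noteq> 0 \<longrightarrow> bdry_dist_dir \<Omega> z v \<le> C * bdry_dist \<Omega> z powr (1 / m))"

(* The library notion of holomorphy is for scalar-valued functions; a map into \<complex>^n is
   holomorphic iff its components are. *)
definition holomorphic_disc :: "(complex ^ 'n) set \<Rightarrow> (complex \<Rightarrow> complex ^ 'n) \<Rightarrow> bool" where
  "holomorphic_disc \<Omega> f \<longleftrightarrow>
     (\<forall>i. (\<lambda>z. f z $ i) holomorphic_on ball 0 1) \<and> f ` ball 0 1 \<subseteq> \<Omega>"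

definition kobayashi_metric :: "(complex ^ 'n) set \<Rightarrow> complex ^ 'n \<Rightarrow> complex ^ 'n \<Rightarrow> real" where
  "kobayashi_metric \<Omega> x v =
     Inf {norm \<xi> | \<xi> f. holomorphic_disc \<Omega> f \<and> f 0 = x \<and>
                        (\<chi> i. deriv (\<lambda>z. f z $ i) 0 * \<xi>) = v}"

(* The integral is taken in [0,\<infinity>], so that the length of every admissible curve is meaningful
   without an integrability side condition. *)
definition kobayashi_length :: "(complex ^ 'n) set \<Rightarrow> (real \<Rightarrow> complex ^ 'n) \<Rightarrow> ennreal" where
  "kobayashi_length \<Omega> \<gamma> =
     (\<integral>\<^sup>+ t\<in>{0..1}. ennreal (kobayashi_metric \<Omega> (\<gamma> t) (vector_derivative \<gamma> (at t))) \<partial>lborel)"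

(* valid_path is the library's predicate for piecewise C^1 curves on [0,1].  For a domain the
   infimum is finite, so enn2real does not collapse an infinite value to 0. *)
definition kobayashi_dist :: "(complex ^ 'n) set \<Rightarrow> complex ^ 'n \<Rightarrow> complex ^ 'n \<Rightarrow> real" where
  "kobayashi_dist \<Omega> x y =
     enn2real (INF \<gamma> \<in> {\<gamma>. valid_path \<gamma> \<and> path_image \<gamma> \<subseteq> \<Omega> \<and> pathstart \<gamma> = x \<and> pathfinish \<gamma> = y}.
                 kobayashi_length \<Omega> \<gamma>)"

(* \<sigma> is the isometric embedding whose image is the geodesic; only its values on
   [0, kobayashi_dist \<Omega> x y] matter. *)
definition kobayashi_geodesic ::
  "(complex ^ 'n) set \<Rightarrow> complex ^ 'n \<Rightarrow> complex ^ 'n \<Rightarrow> (real \<Rightarrow> complex ^ 'n) \<Rightarrow> bool" where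
  "kobayashi_geodesic \<Omega> x y \<sigma> \<longleftrightarrow>
     \<sigma> ` {0..kobayashi_dist \<Omega> x y} \<subseteq> \<Omega> \<and>
     (\<forall>s\<in>{0..kobayashi_dist \<Omega> x y}. \<forall>t\<in>{0..kobayashi_dist \<Omega> x y}.
        kobayashi_dist \<Omega> (\<sigma> s) (\<sigma> t) = \<bar>s - t\<bar>) \<and>
     \<sigma> 0 = x \<and> \<sigma> (kobayashi_dist \<Omega> x y) = y"

(* Euclidean length as the supremum over inscribed polygons.  A geodesic is injective, so the
   length of its parametrisation is the length of its image. *)
definition curve_length :: "real \<Rightarrow> real \<Rightarrow> (real \<Rightarrow> 'a::metric_space) \<Rightarrow> ennreal" where
  "curve_length a b \<sigma> =
     (SUP (k, p) \<in> {(k :: nat, p :: nat \<Rightarrow> real). p 0 = a \<and> p k = b \<and> mono_on {0..k} p}.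
        \<Sum>j<k. ennreal (dist (\<sigma> (p j)) (\<sigma> (p (Suc j)))))"

definition geodesic_length ::
  "(complex ^ 'n) set \<Rightarrow> complex ^ 'n \<Rightarrow> complex ^ 'n \<Rightarrow> (real \<Rightarrow> complex ^ 'n) \<Rightarrow> ennreal" where
  "geodesic_length \<Omega> x y \<sigma> = curve_length 0 (kobayashi_dist \<Omega> x y) \<sigma>"

end

theory Submission
  imports Defs
begin

text \<open>
  Comparing \<open>\<Omega>\<close> with its supporting half-spaces through the Schwarz lemma gives
  \<open>\<delta>(y) \<le> \<delta>(x) e\<^sup>2\<^sup>d\<close> for \<open>d = d\<^sub>K(x,y)\<close>, with sharp constant \<open>2\<close>, and
  \<open>|v| \<le> 2 \<delta>(x;v) K(x;v)\<close>. By \<open>m\<close>-convexity the latter bounds the Euclidean speed of a unit speed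
  Kobayashi geodesic by a multiple of \<open>\<delta>(\<sigma>(s)) powr (1/m)\<close>. The former, applied from both end points,
  yields \<open>\<delta>(\<sigma>(s)) \<le> M exp(-2|s - t0|)\<close> with \<open>M = sqrt(\<delta>(x) \<delta>(y)) exp(d)\<close>. Integrating this
  exponential decay bounds \<open>L\<^sup>m\<close> by a multiple of \<open>M\<close>, and \<open>\<delta>(x), \<delta>(y) \<le> M\<close> as well.
\<close>

section \<open>Schwarz lemma and first bounds on the Kobayashi metric\<close>

text \<open>The Cayley transform centred at \<open>\<phi> 0\<close> carries the right half-plane to
  the disc and \<open>\<phi> 0\<close> to 0. The Schwarz lemma bounds the derivative of the
  composite, which is \<open>deriv \<phi> 0\<close> divided by twice
  \<open>Re (\<phi> 0)\<close>.\<close>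

lemma deriv_right_half_plane_bound:
  assumes hol: "\<phi> holomorphic_on ball 0 1" and pos: "\<And>z. z \<in> ball 0 1 \<Longrightarrow> 0 < Re (\<phi> z)"
  shows "cmod (deriv \<phi> 0) \<le> 2 * Re (\<phi> 0)"
proof -
  define w where "w = \<phi> 0"
  have w: "0 < Re w"
    using pos[of 0] by (simp add: w_def)
  define \<psi> where "\<psi> = (\<lambda>z. (\<phi> z - w) / (\<phi> z + cnj w))"
  have nz: "\<phi> z + cnj w \<noteq> 0" if "z \<in> ball 0 1" for z
    using pos[OF that] w by (auto simp: complex_eq_iff)
  have hol\<psi>: "\<psi> holomorphic_on ball 0 1"
    unfolding \<psi>_def using nz by (intro holomorphic_intros hol) auto
  have "cmod (\<psi> z) < 1" if "cmod z < 1" for z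
  proof -
    have z: "z \<in> ball 0 1" using that by simp
    have "0 < Re (\<phi> z) * Re w" using pos[OF z] w by simp
    \<comment> \<open>The right side exceeds the left by exactly
      \<open>4 * Re (\<phi> z) * Re w\<close>.\<close>
    then have "(cmod (\<phi> z - w))\<^sup>2 < (cmod (\<phi> z + cnj w))\<^sup>2"
      unfolding cmod_power2 by (simp add: power2_eq_square algebra_simps)
    then have "cmod (\<phi> z - w) < cmod (\<phi> z + cnj w)"
      using power_less_imp_less_base by fastforce
    then show ?thesis
      using nz[OF z] by (simp add: \<psi>_def norm_divide divide_less_eq)
  qed
  then have le1: "cmod (deriv \<psi> 0) \<le> 1"
    using Schwarz_Lemma(2)[OF hol\<psi>, of 0] by (simp add: \<psi>_def w_def)
  have "(\<phi> has_field_derivative deriv \<phi> 0) (at 0)"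
    using hol by (intro holomorphic_derivI[where S="ball 0 1"]) auto
  then have "(\<psi> has_field_derivative deriv \<phi> 0 / (w + cnj w)) (at 0)"
    unfolding \<psi>_def using nz[of 0]
    by (auto intro!: derivative_eq_intros simp: w_def)
  then have "deriv \<psi> 0 = deriv \<phi> 0 / (w + cnj w)"
    by (rule DERIV_imp_deriv)
  moreover have "cmod (w + cnj w) = 2 * Re w"
    using w by (simp add: complex_add_cnj norm_mult)
  ultimately show ?thesis
    using le1 w by (simp add: norm_divide divide_le_eq w_def)
qed

text \<open>The Hermitian product, conjugate-linear in \<open>a\<close>, so that it is complex
  linear in \<open>v\<close>. This turns the real functional of a supporting half-space into the
  real part of a holomorphic one.\<close>

definition herm :: "complex ^ 'n \<Rightarrow> complex ^ 'n \<Rightarrow> complex" where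
  "herm a v = (\<Sum>i\<in>UNIV. cnj (a $ i) * v $ i)"

lemma Re_herm: "Re (herm a v) = a \<bullet> v"
  by (simp add: herm_def inner_vec_def inner_complex_def)

lemma herm_cmult: "herm a (k *s v) = k * herm a v"
  by (simp add: herm_def sum_distrib_left algebra_simps)

lemma norm_cmult_vec: "norm (k *s v) = cmod k * norm (v :: complex ^ 'n)"
  by (simp add: norm_vec_def norm_mult L2_set_right_distrib)

text \<open>An affine disc in direction \<open>v\<close> that stays in the ball. It serves both for
  the upper bound on the metric and to show that the infimum defining the metric is over a nonempty
  set.\<close>

lemma kobayashi_witness:
  assumes r: "0 < r" and sub: "ball x r \<subseteq> \<Omega>"
  shows "\<exists>f. holomorphic_disc \<Omega> f \<and> f 0 = x \<and>
    (\<chi> i. deriv (\<lambda>z. f z $ i) 0 * complex_of_real (norm v / r)) = v"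
proof -
  define u where "u = (if v = 0 then 0 else complex_of_real (r / norm v) *s v)"
  define f where "f = (\<lambda>z. x + z *s u)"
  have d: "deriv (\<lambda>z. f z $ i) 0 = u $ i" for i
    unfolding f_def by (rule DERIV_imp_deriv) (auto intro!: derivative_eq_intros)
  have u: "norm u \<le> r"
    using r by (simp add: u_def norm_cmult_vec norm_divide)
  have "norm (z *s u) < r" if "cmod z < 1" for z
  proof -
    have "cmod z * norm u \<le> cmod z * r"
      using u by (intro mult_left_mono) auto
    also have "\<dots> < 1 * r"
      using that r by (intro mult_strict_right_mono) auto
    finally show ?thesis by (simp add: norm_cmult_vec)
  qed
  then have "f ` ball 0 1 \<subseteq> \<Omega>"
    using sub by (force simp: f_def dist_norm)
  then have "holomorphic_disc \<Omega> f"
    unfolding holomorphic_disc_def by (auto simp: f_def intro!: holomorphic_intros)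
  moreover have "(\<chi> i. deriv (\<lambda>z. f z $ i) 0 * complex_of_real (norm v / r)) = v"
    using r by (auto simp: d u_def vec_eq_iff)
  moreover have "f 0 = x"
    by (simp add: f_def vec_eq_iff)
  ultimately show ?thesis by blast
qed

lemma kobayashi_metric_le:
  assumes "0 < r" "ball x r \<subseteq> \<Omega>"
  shows "kobayashi_metric \<Omega> x v \<le> norm v / r"
proof -
  obtain f where f: "holomorphic_disc \<Omega> f" "f 0 = x"
    "(\<chi> i. deriv (\<lambda>z. f z $ i) 0 * complex_of_real (norm v / r)) = v"
    using kobayashi_witness[OF assms] by blast
  have "norm v / r = norm (complex_of_real (norm v / r))"
    using assms(1) by (simp only: norm_of_real) simp
  then have "norm v / r \<in> {norm \<xi> | \<xi> f. holomorphic_disc \<Omega> f \<and> f 0 = x \<and>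
                        (\<chi> i. deriv (\<lambda>z. f z $ i) 0 * \<xi>) = v}"
    using f by blast
  then show ?thesis
    unfolding kobayashi_metric_def by (rule cInf_lower) (auto intro!: bdd_belowI[of _ 0])
qed

lemma kobayashi_metric_greatest:
  assumes \<Omega>: "open \<Omega>" "x \<in> \<Omega>"
    and le: "\<And>f \<xi>. holomorphic_disc \<Omega> f \<Longrightarrow> f 0 = x \<Longrightarrow>
      (\<chi> i. deriv (\<lambda>z. f z $ i) 0 * \<xi>) = v \<Longrightarrow> b \<le> cmod \<xi>"
  shows "b \<le> kobayashi_metric \<Omega> x v"
proof -
  obtain r where "0 < r" "ball x r \<subseteq> \<Omega>"
    using \<Omega> openE by blast
  then have "{norm \<xi> | \<xi> f. holomorphic_disc \<Omega> f \<and> f 0 = x \<and>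
                        (\<chi> i. deriv (\<lambda>z. f z $ i) 0 * \<xi>) = v} \<noteq> {}"
    using kobayashi_witness[of r x \<Omega> v] by blast
  then show ?thesis
    unfolding kobayashi_metric_def using le by (intro cInf_greatest) auto
qed

lemma kobayashi_metric_nonneg:
  "open \<Omega> \<Longrightarrow> x \<in> \<Omega> \<Longrightarrow> 0 \<le> kobayashi_metric \<Omega> x v"
  by (rule kobayashi_metric_greatest) auto

text \<open>Composing a competing disc with the affine functional \<open>herm a _ - c\<close> gives
  a map into the right half-plane, whose derivative at 0 is bounded by twice its real part there.
  This 2 is the source of every later \<open>exp (2 * l)\<close>.\<close>

lemma kobayashi_metric_half_space:
  assumes \<Omega>: "open \<Omega>" "x \<in> \<Omega>" and half: "\<And>z. z \<in> \<Omega> \<Longrightarrow> c < a \<bullet> z"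
  shows "cmod (herm a v) \<le> 2 * (a \<bullet> x - c) * kobayashi_metric \<Omega> x v"
proof -
  have pos: "0 < 2 * (a \<bullet> x - c)"
    using half[OF \<Omega>(2)] by simp
  have "cmod (herm a v) / (2 * (a \<bullet> x - c)) \<le> kobayashi_metric \<Omega> x v"
  proof (rule kobayashi_metric_greatest[OF \<Omega>])
    fix f \<xi>
    assume f: "holomorphic_disc \<Omega> f" "f 0 = x"
      and v: "(\<chi> i. deriv (\<lambda>z. f z $ i) 0 * \<xi>) = v"
    define \<phi> where "\<phi> = (\<lambda>z. herm a (f z) - complex_of_real c)"
    have hol: "(\<lambda>z. f z $ i) holomorphic_on ball 0 1" for i
      using f by (auto simp: holomorphic_disc_def)
    have hol\<phi>: "\<phi> holomorphic_on ball 0 1"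
      unfolding \<phi>_def herm_def by (intro holomorphic_intros hol)
    have "0 < Re (\<phi> z)" if "z \<in> ball 0 1" for z
      using f(1) that half by (fastforce simp: holomorphic_disc_def \<phi>_def Re_herm)
    then have le: "cmod (deriv \<phi> 0) \<le> 2 * (a \<bullet> x - c)"
      using deriv_right_half_plane_bound[OF hol\<phi>] f(2) by (simp add: \<phi>_def Re_herm)
    have "((\<lambda>z. f z $ i) has_field_derivative deriv (\<lambda>z. f z $ i) 0) (at 0)" for i
      using hol by (intro holomorphic_derivI[where S="ball 0 1"]) auto
    then have "(\<phi> has_field_derivative (\<Sum>i\<in>UNIV. cnj (a $ i) * deriv (\<lambda>z. f z $ i) 0)) (at 0)"
      unfolding \<phi>_def herm_def
      by (auto intro!: derivative_eq_intros sum.cong simp: mult.commute)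
    then have "deriv \<phi> 0 = (\<Sum>i\<in>UNIV. cnj (a $ i) * deriv (\<lambda>z. f z $ i) 0)"
      by (rule DERIV_imp_deriv)
    then have "herm a v = deriv \<phi> 0 * \<xi>"
      unfolding v[symmetric] by (simp add: herm_def sum_distrib_right mult.assoc)
    then have "cmod (herm a v) \<le> 2 * (a \<bullet> x - c) * cmod \<xi>"
      using le by (simp add: norm_mult mult_right_mono)
    then show "cmod (herm a v) / (2 * (a \<bullet> x - c)) \<le> cmod \<xi>"
      using pos by (simp add: divide_le_eq mult.commute)
  qed
  then show ?thesis
    using pos by (simp add: divide_le_eq mult.commute)
qed

section \<open>Supporting half-spaces and the distance to the boundary\<close>

text \<open>A supporting hyperplane is strict on the relative interior, which is all of
  \<open>\<Omega>\<close> because \<open>\<Omega>\<close> is open.\<close>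

lemma bounded_convex_domain_support:
  fixes \<Omega> :: "(complex ^ 'n) set"
  assumes "bounded_convex_domain \<Omega>" "\<xi> \<in> frontier \<Omega>"
  obtains a where "norm a = 1" "\<And>z. z \<in> \<Omega> \<Longrightarrow> a \<bullet> \<xi> < a \<bullet> z"
proof -
  have \<Omega>: "open \<Omega>" "convex \<Omega>"
    using assms by (auto simp: bounded_convex_domain_def)
  then have "rel_interior \<Omega> = \<Omega>"
    by (simp add: rel_interior_open)
  moreover have "\<xi> \<in> closure \<Omega>" "\<xi> \<notin> \<Omega>"
    using assms(2) \<Omega>(1) by (auto simp: frontier_def interior_open)
  ultimately obtain b where b: "b \<noteq> 0" "\<And>z. z \<in> \<Omega> \<Longrightarrow> b \<bullet> \<xi> < b \<bullet> z"
    using supporting_hyperplane_relative_frontier[OF \<Omega>(2), of \<xi>] by metis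
  show thesis
  proof (rule that[of "sgn b"])
    show "norm (sgn b) = 1" using b by (simp add: norm_sgn)
    show "sgn b \<bullet> \<xi> < sgn b \<bullet> z" if "z \<in> \<Omega>" for z
      using b(1) b(2)[OF that] by (simp add: sgn_div_norm mult_strict_left_mono)
  qed
qed

text \<open>Since \<open>infdist\<close> to the empty set is 0 by default, positivity of
  \<open>bdry_dist\<close> depends on this.\<close>

lemma bounded_convex_domain_frontier:
  fixes \<Omega> :: "(complex ^ 'n) set"
  assumes "bounded_convex_domain \<Omega>"
  shows "frontier \<Omega> \<noteq> {}"
proof -
  have "\<Omega> \<noteq> UNIV"
    using assms by (auto simp: bounded_convex_domain_def)
  then show ?thesis
    using assms by (auto simp: bounded_convex_domain_def frontier_eq_empty)
qed

lemma bdry_dist_pos: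
  fixes \<Omega> :: "(complex ^ 'n) set"
  assumes "bounded_convex_domain \<Omega>" "x \<in> \<Omega>"
  shows "0 < bdry_dist \<Omega> x"
proof -
  have "x \<notin> frontier \<Omega>"
    using assms by (auto simp: bounded_convex_domain_def frontier_def interior_open)
  then show ?thesis
    using bounded_convex_domain_frontier[OF assms(1)] unfolding bdry_dist_def
    by (simp add: infdist_pos_not_in_closed)
qed

text \<open>The orthogonal projection of \<open>x\<close> to the bounding hyperplane lies outside
  \<open>\<Omega>\<close>, so the segment towards it meets the frontier.\<close>

lemma bdry_dist_le_half_space:
  fixes \<Omega> :: "(complex ^ 'n) set"
  assumes x: "x \<in> \<Omega>" and a: "norm a = 1" and half: "\<And>z. z \<in> \<Omega> \<Longrightarrow> c < a \<bullet> z"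
  shows "bdry_dist \<Omega> x \<le> a \<bullet> x - c"
proof -
  define y where "y = x - (a \<bullet> x - c) *\<^sub>R a"
  have "a \<bullet> a = 1" using a by (simp add: norm_eq_sqrt_inner)
  then have "a \<bullet> y = c" by (simp add: y_def inner_diff_right)
  then have "y \<notin> \<Omega>" using half by force
  then obtain w where w: "w \<in> closed_segment x y" "w \<in> frontier \<Omega>"
    using connected_Int_frontier[of "closed_segment x y" \<Omega>] x by auto
  have "bdry_dist \<Omega> x \<le> dist x w"
    unfolding bdry_dist_def using w(2) by (rule infdist_le)
  also have "\<dots> \<le> dist x y"
    using dist_in_closed_segment[OF w(1)] by (simp add: dist_commute)
  also have "\<dots> = a \<bullet> x - c"
    using a half[OF x] by (simp add: y_def dist_norm)
  finally show ?thesis .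
qed

text \<open>For each frontier point \<open>\<xi> = x + k *s v\<close>, the half-space supporting at
  \<open>\<xi>\<close> has gap at most \<open>cmod k * cmod (herm a v)\<close> at \<open>x\<close>.
  In the half-space estimate the factor \<open>cmod (herm a v)\<close> then cancels, leaving
  \<open>1 \<le> 2 * cmod k * K\<close>.\<close>

lemma kobayashi_metric_ge_dir:
  fixes \<Omega> :: "(complex ^ 'n) set"
  assumes \<Omega>: "bounded_convex_domain \<Omega>" and x: "x \<in> \<Omega>" and v: "v \<noteq> 0"
  shows "norm v \<le> 2 * bdry_dist_dir \<Omega> x v * kobayashi_metric \<Omega> x v"
proof -
  let ?K = "kobayashi_metric \<Omega> x v"
  have op: "open \<Omega>" and bd: "bounded \<Omega>"
    using \<Omega> by (auto simp: bounded_convex_domain_def)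
  have K0: "0 \<le> ?K"
    using op x by (rule kobayashi_metric_nonneg)
  have ge: "norm v \<le> 2 * dist x \<xi> * ?K" if \<xi>: "\<xi> \<in> frontier \<Omega> \<inter> complex_line x v" for \<xi>
  proof -
    obtain a where a: "norm a = 1" "\<And>z. z \<in> \<Omega> \<Longrightarrow> a \<bullet> \<xi> < a \<bullet> z"
      using bounded_convex_domain_support[OF \<Omega>, of \<xi>] \<xi> by auto
    obtain k where k: "\<xi> = x + k *s v"
      using \<xi> by (auto simp: complex_line_def)
    have "a \<bullet> x - a \<bullet> \<xi> = - Re (k * herm a v)"
      by (simp add: k inner_add_right Re_herm flip: herm_cmult)
    also have "\<dots> \<le> cmod k * cmod (herm a v)"
      using complex_Re_le_cmod[of "- (k * herm a v)"] by (simp add: norm_mult)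
    finally have g: "a \<bullet> x - a \<bullet> \<xi> \<le> cmod k * cmod (herm a v)" .
    have g0: "0 < a \<bullet> x - a \<bullet> \<xi>" using a(2)[OF x] by simp
    have h0: "0 < cmod (herm a v)"
      using g g0 by (cases "herm a v = 0") auto
    have "cmod (herm a v) \<le> 2 * (a \<bullet> x - a \<bullet> \<xi>) * ?K"
      by (rule kobayashi_metric_half_space[OF op x a(2)])
    also have "\<dots> \<le> 2 * (cmod k * cmod (herm a v)) * ?K"
      using g K0 by (intro mult_right_mono mult_left_mono) auto
    finally have "cmod (herm a v) * 1 \<le> cmod (herm a v) * (2 * cmod k * ?K)"
      by (simp add: algebra_simps)
    then have "1 \<le> 2 * cmod k * ?K"
      using h0 by (simp only: mult_le_cancel_left_pos)
    then have "norm v * 1 \<le> norm v * (2 * cmod k * ?K)"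
      by (intro mult_left_mono) auto
    moreover have "dist x \<xi> = cmod k * norm v"
      by (simp add: k dist_norm norm_cmult_vec)
    ultimately show ?thesis by (simp add: algebra_simps)
  qed
  \<comment> \<open>Without such a point \<open>bdry_dist_dir\<close> would take the default value 0
    and the claim would fail.\<close>
  have "frontier \<Omega> \<inter> complex_line x v \<noteq> {}"
  proof -
    obtain B where B: "\<And>z. z \<in> \<Omega> \<Longrightarrow> norm z \<le> B"
      using bd bounded_iff by blast
    \<comment> \<open>Chosen so that \<open>x + k *s v\<close> has norm at least
      \<open>B + 1\<close> and so lies outside \<open>\<Omega>\<close>.\<close>
    define k where "k = complex_of_real ((B + norm x + 1) / norm v)"
    define y where "y = x + k *s v"
    have "0 \<le> B" using B[OF x] norm_ge_zero order_trans by blast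
    then have "norm (k *s v) = B + norm x + 1"
      using v unfolding norm_cmult_vec k_def norm_of_real by simp
    then have "B < norm y"
      using norm_triangle_ineq4[of y x] by (simp add: y_def)
    then have "y \<notin> \<Omega>" using B by force
    then obtain w where w: "w \<in> closed_segment x y" "w \<in> frontier \<Omega>"
      using connected_Int_frontier[of "closed_segment x y" \<Omega>] x by auto
    then obtain t :: real where "w = (1 - t) *\<^sub>R x + t *\<^sub>R y"
      by (auto simp: closed_segment_def)
    then have "w = x + (complex_of_real t * k) *s v"
      unfolding y_def vec_eq_iff
      by (simp add: algebra_simps) (simp add: scaleR_conv_of_real algebra_simps)
    then show ?thesis using w(2) by (auto simp: complex_line_def)
  qed
  \<comment> \<open>If the metric vanished, \<open>ge\<close> at any frontier point on the line
    would force \<open>v = 0\<close>.\<close>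
  moreover have "0 < ?K"
  proof (rule ccontr)
    assume "\<not> 0 < ?K"
    then show False using ge calculation K0 v by fastforce
  qed
  moreover have "norm v / (2 * ?K) \<le> dist x \<xi>" if "\<xi> \<in> frontier \<Omega> \<inter> complex_line x v" for \<xi>
    using ge[OF that] \<open>0 < ?K\<close> by (simp add: divide_le_eq mult_ac)
  ultimately have "norm v / (2 * ?K) \<le> bdry_dist_dir \<Omega> x v"
    unfolding bdry_dist_dir_def infdist_def
    by (simp only: if_False) (intro cINF_greatest)
  then show ?thesis
    using \<open>0 < ?K\<close> by (simp add: divide_le_eq algebra_simps)
qed


section \<open>Growth estimates along a path\<close>

text \<open>No measurability of \<open>W\<close> is assumed: it is not known for the Kobayashi metric along a curve,
  whose \<open>nn_integral\<close> is then a lower integral.\<close>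

lemma norm_diff_le_nn_integral:
  fixes u :: "real \<Rightarrow> 'a::euclidean_space"
  assumes "finite S" "a \<le> b" and cont: "continuous_on {a..b} u"
    and der: "\<And>t. t \<in> {a<..<b} - S \<Longrightarrow> (u has_vector_derivative D t) (at t)"
    and contD: "continuous_on ({a<..<b} - S) D"
    and le: "\<And>t. t \<in> {a<..<b} - S \<Longrightarrow> norm (D t) \<le> W t"
    and A: "{a<..<b} \<subseteq> A"
  shows "ennreal (norm (u b - u a)) \<le> (\<integral>\<^sup>+ t\<in>A. ennreal (W t) \<partial>lborel)"
proof (cases "(\<integral>\<^sup>+ t\<in>A. ennreal (W t) \<partial>lborel) = \<infinity>")
  case False
  define I where "I = {a<..<b} - S"
  \<comment> \<open>The derivative of \<open>u\<close> extended by 0. Unlike \<open>W\<close> it is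
    known to be measurable, so the Bochner integral and the fundamental theorem apply to it, while
    \<open>W\<close> enters only through monotonicity.\<close>
  define E where "E = (\<lambda>t. indicator I t *\<^sub>R D t)"
  have "open I"
    using \<open>finite S\<close> by (simp add: I_def open_Diff finite_imp_closed)
  then have meas: "E \<in> borel_measurable lborel"
    using contD unfolding E_def I_def[symmetric]
    by (simp add: borel_measurable_continuous_on_indicator)
  have int: "(\<integral>\<^sup>+ t. norm (E t) \<partial>lborel) \<le> (\<integral>\<^sup>+ t\<in>A. ennreal (W t) \<partial>lborel)"
    using le A by (intro nn_integral_mono) (auto simp: E_def I_def indicator_def intro!: ennreal_leI)
  have E: "integrable lborel E"
    using meas int False by (intro integrableI_bounded) (auto simp: less_top intro: order_le_less_trans)
  have "(E has_integral (u b - u a)) {a..b}"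
    using assms(1,2) cont der
    by (intro fundamental_theorem_of_calculus_interior_strong[of S]) (auto simp: E_def I_def)
  then have "(E has_integral (u b - u a)) UNIV"
    by (rule has_integral_on_superset) (auto simp: E_def I_def indicator_def)
  then have "u b - u a = integral\<^sup>L lborel E"
    using has_integral_integral_lborel[OF E] has_integral_unique by blast
  then show ?thesis
    using integral_norm_bound_ennreal[OF E] int order_trans by metis
qed simp

lemma valid_path_derivative:
  assumes "valid_path \<gamma>"
  obtains S where "finite S" "continuous_on {0..1} \<gamma>"
    "\<And>t. t \<in> {0..1} - S \<Longrightarrow> (\<gamma> has_vector_derivative vector_derivative \<gamma> (at t)) (at t)"
    "continuous_on ({0..1} - S) (\<lambda>t. vector_derivative \<gamma> (at t))"
  using assms that
  unfolding valid_path_def piecewise_C1_differentiable_on_def C1_differentiable_on_eq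
    vector_derivative_works
  by blast

text \<open>Half the logarithm of the gap has derivative at most the Kobayashi speed, so it changes
  by at most \<open>l\<close>. Allowing every intermediate \<open>r\<close> gives control of the
  whole path, which the Euclidean estimate below needs.\<close>

lemma half_space_growth:
  assumes \<Omega>: "open \<Omega>" and half: "\<And>z. z \<in> \<Omega> \<Longrightarrow> c < a \<bullet> z"
    and \<gamma>: "valid_path \<gamma>" "path_image \<gamma> \<subseteq> \<Omega>"
    and len: "kobayashi_length \<Omega> \<gamma> \<le> ennreal l" and l: "0 \<le> l" and r: "r \<in> {0..1}"
  shows "a \<bullet> \<gamma> r - c \<le> (a \<bullet> \<gamma> 0 - c) * exp (2 * l)"
proof -
  obtain S where S: "finite S" "continuous_on {0..1} \<gamma>"
    "\<And>t. t \<in> {0..1} - S \<Longrightarrow> (\<gamma> has_vector_derivative vector_derivative \<gamma> (at t)) (at t)"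
    "continuous_on ({0..1} - S) (\<lambda>t. vector_derivative \<gamma> (at t))"
    using valid_path_derivative[OF \<gamma>(1)] by blast
  have in\<Omega>: "\<gamma> t \<in> \<Omega>" if "t \<in> {0..1}" for t
    using \<gamma>(2) that by (auto simp: path_image_def)
  define g where "g = (\<lambda>t. a \<bullet> \<gamma> t - c)"
  have g: "0 < g t" if "t \<in> {0..1}" for t
    using half[OF in\<Omega>[OF that]] by (simp add: g_def)
  have contg: "continuous_on {0..1} g"
    unfolding g_def by (intro continuous_intros S(2))
  define u where "u = (\<lambda>t. ln (g t) / 2)"
  define D where "D = (\<lambda>t. (a \<bullet> vector_derivative \<gamma> (at t)) / (2 * g t))"
  have "ennreal (norm (u r - u 0)) \<le> kobayashi_length \<Omega> \<gamma>"
    unfolding kobayashi_length_def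
  proof (rule norm_diff_le_nn_integral[OF S(1), where u=u and a=0 and b=r and D=D])
    show "continuous_on {0..r} u"
      unfolding u_def using r g
      by (intro continuous_intros continuous_on_subset[OF contg]) force+
    show "continuous_on ({0<..<r} - S) D"
      unfolding D_def using r g
      by (intro continuous_intros continuous_on_subset[OF contg] continuous_on_subset[OF S(4)])
        (auto simp: less_imp_neq[symmetric])
  next
    fix t assume t: "t \<in> {0<..<r} - S"
    then have t1: "t \<in> {0..1}" using r by auto
    have "(g has_real_derivative a \<bullet> vector_derivative \<gamma> (at t)) (at t)"
      unfolding g_def has_real_derivative_iff_has_vector_derivative
      using S(3)[of t] t r
      by (auto intro!: derivative_eq_intros bounded_linear.has_vector_derivative[OF bounded_linear_inner_right])
    then have "(u has_real_derivative D t) (at t)"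
      unfolding u_def D_def using g[OF t1] by (auto intro!: derivative_eq_intros simp: field_simps)
    then show "(u has_vector_derivative D t) (at t)"
      by (simp add: has_real_derivative_iff_has_vector_derivative)
    let ?v = "vector_derivative \<gamma> (at t)"
    have "\<bar>a \<bullet> ?v\<bar> \<le> cmod (herm a ?v)"
      using abs_Re_le_cmod[of "herm a ?v"] by (simp add: Re_herm)
    also have "\<dots> \<le> 2 * g t * kobayashi_metric \<Omega> (\<gamma> t) ?v"
      unfolding g_def by (rule kobayashi_metric_half_space[OF \<Omega> in\<Omega>[OF t1] half])
    finally show "norm (D t) \<le> kobayashi_metric \<Omega> (\<gamma> t) ?v"
      using g[OF t1] by (simp add: D_def abs_mult divide_le_eq algebra_simps)
  qed (use r in auto)
  with len have "ennreal (norm (u r - u 0)) \<le> ennreal l"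
    by (rule order_trans[rotated])
  then have "ln (g r) - ln (g 0) \<le> 2 * l"
    using l by (simp add: u_def)
  then have "ln (g r) \<le> ln (g 0 * exp (2 * l))"
    using g[of 0] by (simp add: ln_mult)
  then show ?thesis
    using g[of 0] g[OF r] by (simp add: g_def)
qed

text \<open>Take the half-space supporting at a frontier point nearest to \<open>\<gamma> 0\<close>.
  By Cauchy-Schwarz its gap at \<open>\<gamma> 0\<close> is at most the boundary distance, and at
  \<open>\<gamma> r\<close> the gap is at least the boundary distance.\<close>

lemma bdry_dist_path:
  fixes \<Omega> :: "(complex ^ 'n) set"
  assumes \<Omega>: "bounded_convex_domain \<Omega>"
    and \<gamma>: "valid_path \<gamma>" "path_image \<gamma> \<subseteq> \<Omega>"
    and len: "kobayashi_length \<Omega> \<gamma> \<le> ennreal l" and l: "0 \<le> l" and r: "r \<in> {0..1}"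
  shows "bdry_dist \<Omega> (\<gamma> r) \<le> bdry_dist \<Omega> (\<gamma> 0) * exp (2 * l)"
proof -
  have op: "open \<Omega>" using \<Omega> by (simp add: bounded_convex_domain_def)
  have in\<Omega>: "\<gamma> t \<in> \<Omega>" if "t \<in> {0..1}" for t
    using \<gamma>(2) that by (auto simp: path_image_def)
  obtain \<xi> where \<xi>: "\<xi> \<in> frontier \<Omega>" "bdry_dist \<Omega> (\<gamma> 0) = dist (\<gamma> 0) \<xi>"
    unfolding bdry_dist_def
    using infdist_attains_inf[of "frontier \<Omega>"] bounded_convex_domain_frontier[OF \<Omega>] by auto
  obtain a where a: "norm a = 1" "\<And>z. z \<in> \<Omega> \<Longrightarrow> a \<bullet> \<xi> < a \<bullet> z"
    using bounded_convex_domain_support[OF \<Omega> \<xi>(1)] by blast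
  have "bdry_dist \<Omega> (\<gamma> r) \<le> a \<bullet> \<gamma> r - a \<bullet> \<xi>"
    by (rule bdry_dist_le_half_space[OF in\<Omega>[OF r] a])
  also have "\<dots> \<le> (a \<bullet> \<gamma> 0 - a \<bullet> \<xi>) * exp (2 * l)"
    by (rule half_space_growth[OF op a(2) \<gamma> len l r])
  also have "\<dots> \<le> bdry_dist \<Omega> (\<gamma> 0) * exp (2 * l)"
    using norm_cauchy_schwarz[of a "\<gamma> 0 - \<xi>"] a(1)
    by (intro mult_right_mono) (auto simp: \<xi>(2) dist_norm inner_diff_right)
  finally show ?thesis .
qed

text \<open>On the whole path the boundary distance stays below its initial value times
  \<open>exp (2 * l)\<close>. With \<open>mc\<close> and the directional estimate this makes the
  Euclidean speed at most a fixed multiple of the Kobayashi speed.\<close>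

lemma dist_path_le:
  fixes \<Omega> :: "(complex ^ 'n) set"
  assumes \<Omega>: "bounded_convex_domain \<Omega>" and C: "0 < C" and m: "0 < m"
    and mc: "\<And>z v. z \<in> \<Omega> \<Longrightarrow> v \<noteq> 0 \<Longrightarrow> bdry_dist_dir \<Omega> z v \<le> C * bdry_dist \<Omega> z powr (1 / m)"
    and \<gamma>: "valid_path \<gamma>" "path_image \<gamma> \<subseteq> \<Omega>"
    and len: "kobayashi_length \<Omega> \<gamma> \<le> ennreal l" and l: "0 \<le> l"
  shows "dist (\<gamma> 0) (\<gamma> 1) \<le> 2 * C * (bdry_dist \<Omega> (\<gamma> 0) * exp (2 * l)) powr (1 / m) * l"
proof -
  have op: "open \<Omega>" using \<Omega> by (simp add: bounded_convex_domain_def)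
  obtain S where S: "finite S" "continuous_on {0..1} \<gamma>"
    "\<And>t. t \<in> {0..1} - S \<Longrightarrow> (\<gamma> has_vector_derivative vector_derivative \<gamma> (at t)) (at t)"
    "continuous_on ({0..1} - S) (\<lambda>t. vector_derivative \<gamma> (at t))"
    using valid_path_derivative[OF \<gamma>(1)] by blast
  have in\<Omega>: "\<gamma> t \<in> \<Omega>" if "t \<in> {0..1}" for t
    using \<gamma>(2) that by (auto simp: path_image_def)
  define B where "B = 2 * C * (bdry_dist \<Omega> (\<gamma> 0) * exp (2 * l)) powr (1 / m)"
  have B: "0 < B"
    using C bdry_dist_pos[OF \<Omega> in\<Omega>[of 0]] by (simp add: B_def)
  \<comment> \<open>Absorbing \<open>B\<close> into the path avoids taking a constant out of an
    integral whose integrand is not known to be measurable.\<close>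
  define u where "u = (\<lambda>t. \<gamma> t /\<^sub>R B)"
  have "ennreal (norm (u 1 - u 0)) \<le> kobayashi_length \<Omega> \<gamma>"
    unfolding kobayashi_length_def
  proof (rule norm_diff_le_nn_integral[OF S(1), where u=u and a=0 and b=1 and D="\<lambda>t. vector_derivative \<gamma> (at t) /\<^sub>R B"])
    show "continuous_on {0..1} u"
      unfolding u_def by (intro continuous_intros S(2))
    show "continuous_on ({0<..<1} - S) (\<lambda>t. vector_derivative \<gamma> (at t) /\<^sub>R B)"
      by (intro continuous_intros continuous_on_subset[OF S(4)]) auto
  next
    fix t assume t: "t \<in> {0<..<1::real} - S"
    then have t1: "t \<in> {0..1}" by auto
    let ?v = "vector_derivative \<gamma> (at t)" and ?K = "kobayashi_metric \<Omega> (\<gamma> t) (vector_derivative \<gamma> (at t))"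
    show "(u has_vector_derivative ?v /\<^sub>R B) (at t)"
      unfolding u_def using S(3)[of t] t
      by (auto intro!: bounded_linear.has_vector_derivative[OF bounded_linear_scaleR_right])
    have K: "0 \<le> ?K"
      by (rule kobayashi_metric_nonneg[OF op in\<Omega>[OF t1]])
    have "norm ?v \<le> B * ?K"
    proof (cases "?v = 0")
      case False
      have "bdry_dist_dir \<Omega> (\<gamma> t) ?v \<le> C * bdry_dist \<Omega> (\<gamma> t) powr (1 / m)"
        by (rule mc[OF in\<Omega>[OF t1] False])
      also have "\<dots> \<le> C * (bdry_dist \<Omega> (\<gamma> 0) * exp (2 * l)) powr (1 / m)"
        using C m bdry_dist_path[OF \<Omega> \<gamma> len l t1] bdry_dist_pos[OF \<Omega> in\<Omega>[OF t1]]
        by (intro mult_left_mono powr_mono2) auto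
      finally have "2 * bdry_dist_dir \<Omega> (\<gamma> t) ?v * ?K \<le> B * ?K"
        using K by (intro mult_right_mono) (auto simp: B_def)
      then show ?thesis
        using kobayashi_metric_ge_dir[OF \<Omega> in\<Omega>[OF t1] False] by linarith
    qed (use B K in simp)
    then show "norm (?v /\<^sub>R B) \<le> ?K"
      using B by (simp add: field_simps)
  qed auto
  with len have "ennreal (norm (u 1 - u 0)) \<le> ennreal l"
    by (rule order_trans[rotated])
  then have "norm (u 1 - u 0) \<le> l"
    using l by simp
  moreover have "u 1 - u 0 = (\<gamma> 1 - \<gamma> 0) /\<^sub>R B"
    by (simp add: u_def scaleR_diff_right)
  ultimately have "norm (\<gamma> 1 - \<gamma> 0) / B \<le> l"
    using B by (simp add: divide_inverse_commute)
  then have "norm (\<gamma> 1 - \<gamma> 0) \<le> B * l"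
    using B by (simp add: divide_le_eq mult.commute)
  then show ?thesis
    by (simp add: B_def dist_norm norm_minus_commute)
qed

section \<open>From paths to the Kobayashi distance\<close>

text \<open>Compactness of the segment gives one radius of inscribed balls for all its points, hence
  a bounded integrand. The resulting finite competitor ensures that \<open>enn2real\<close> loses
  nothing in \<open>kobayashi_dist\<close>.\<close>

lemma kobayashi_length_linepath:
  fixes \<Omega> :: "(complex ^ 'n) set"
  assumes "open \<Omega>" "convex \<Omega>" "x \<in> \<Omega>" "y \<in> \<Omega>"
  shows "kobayashi_length \<Omega> (linepath x y) < \<infinity>"
proof -
  have seg: "closed_segment x y \<subseteq> \<Omega>"
    using assms by (simp add: closed_segment_subset)
  obtain r where r: "0 < r" "(\<Union>z\<in>closed_segment x y. ball z r) \<subseteq> \<Omega>"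
    using compact_subset_open_imp_ball_epsilon_subset[OF compact_segment assms(1) seg] by blast
  have K: "kobayashi_metric \<Omega> (linepath x y t) v \<le> norm v / r" if "t \<in> {0..1}" for t v
  proof (rule kobayashi_metric_le[OF r(1)])
    show "ball (linepath x y t) r \<subseteq> \<Omega>"
      using r(2) linepath_in_path[OF that, of x y] by blast
  qed
  have "kobayashi_length \<Omega> (linepath x y) \<le> (\<integral>\<^sup>+ t\<in>{0..1::real}. ennreal (norm (y - x) / r) \<partial>lborel)"
    unfolding kobayashi_length_def using K
    by (intro nn_integral_mono) (auto simp: indicator_def intro!: ennreal_leI)
  also have "\<dots> < \<infinity>"
    by (simp add: nn_integral_cmult)
  finally show ?thesis .
qed

lemma kobayashi_dist_path:
  fixes \<Omega> :: "(complex ^ 'n) set"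
  assumes "bounded_convex_domain \<Omega>" and xy: "x \<in> \<Omega>" "y \<in> \<Omega>"
    and l: "kobayashi_dist \<Omega> x y < l"
  obtains \<gamma> where "valid_path \<gamma>" "path_image \<gamma> \<subseteq> \<Omega>" "\<gamma> 0 = x" "\<gamma> 1 = y"
    "kobayashi_length \<Omega> \<gamma> \<le> ennreal l"
proof -
  have \<Omega>: "open \<Omega>" "convex \<Omega>"
    using assms by (auto simp: bounded_convex_domain_def)
  let ?P = "{\<gamma>. valid_path \<gamma> \<and> path_image \<gamma> \<subseteq> \<Omega> \<and> pathstart \<gamma> = x \<and> pathfinish \<gamma> = y}"
  have "linepath x y \<in> ?P"
    using \<Omega> xy by (simp add: closed_segment_subset)
  then have "(INF \<gamma>\<in>?P. kobayashi_length \<Omega> \<gamma>) \<le> kobayashi_length \<Omega> (linepath x y)"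
    by (rule INF_lower)
  then have fin: "(INF \<gamma>\<in>?P. kobayashi_length \<Omega> \<gamma>) < \<infinity>"
    using kobayashi_length_linepath[OF \<Omega> xy] by (rule order_le_less_trans)
  have "(INF \<gamma>\<in>?P. kobayashi_length \<Omega> \<gamma>) = ennreal (kobayashi_dist \<Omega> x y)"
    unfolding kobayashi_dist_def using fin by (subst ennreal_enn2real) (simp_all only: infinity_ennreal_def)
  also have "\<dots> < ennreal l"
    using l by (intro ennreal_lessI) (auto simp: kobayashi_dist_def intro: order_le_less_trans[OF enn2real_nonneg])
  finally have "(INF \<gamma>\<in>?P. kobayashi_length \<Omega> \<gamma>) < ennreal l" .
  then obtain \<gamma> where "\<gamma> \<in> ?P" "kobayashi_length \<Omega> \<gamma> < ennreal l"
    by (auto simp: INF_less_iff)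
  then show thesis
    by (intro that[of \<gamma>]) (auto simp: pathstart_def pathfinish_def)
qed

lemma kobayashi_dist_nonneg: "0 \<le> kobayashi_dist \<Omega> x y"
  by (simp add: kobayashi_dist_def)

text \<open>The infimum over paths need not be attained, so path estimates are available for each
  \<open>l\<close> above the distance; this carries them to the distance itself.\<close>

lemma le_isCont_limit:
  fixes f :: "real \<Rightarrow> real"
  assumes "isCont f d" and "\<And>l. d < l \<Longrightarrow> b \<le> f l"
  shows "b \<le> f d"
proof (rule tendsto_lowerbound)
  show "(f \<longlongrightarrow> f d) (at_right d)"
    using assms(1) by (simp add: continuous_at_imp_continuous_at_within flip: continuous_within)
  show "\<forall>\<^sub>F l in at_right d. b \<le> f l"
    using assms(2) by (auto simp: eventually_at_filter)
qed simp

lemma bdry_dist_le_exp: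
  fixes \<Omega> :: "(complex ^ 'n) set"
  assumes \<Omega>: "bounded_convex_domain \<Omega>" and xy: "x \<in> \<Omega>" "y \<in> \<Omega>"
  shows "bdry_dist \<Omega> y \<le> bdry_dist \<Omega> x * exp (2 * kobayashi_dist \<Omega> x y)"
proof (rule le_isCont_limit[where f="\<lambda>l. bdry_dist \<Omega> x * exp (2 * l)"])
  show "isCont (\<lambda>l. bdry_dist \<Omega> x * exp (2 * l)) (kobayashi_dist \<Omega> x y)"
    by (intro continuous_intros)
  fix l assume l: "kobayashi_dist \<Omega> x y < l"
  obtain \<gamma> where \<gamma>: "valid_path \<gamma>" "path_image \<gamma> \<subseteq> \<Omega>" "\<gamma> 0 = x" "\<gamma> 1 = y"
    "kobayashi_length \<Omega> \<gamma> \<le> ennreal l"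
    using kobayashi_dist_path[OF \<Omega> xy l] .
  show "bdry_dist \<Omega> y \<le> bdry_dist \<Omega> x * exp (2 * l)"
    using bdry_dist_path[OF \<Omega> \<gamma>(1,2,5), of 1] \<gamma>(3,4) l kobayashi_dist_nonneg[of \<Omega> x y] by simp
qed

lemma dist_le_kobayashi_dist:
  fixes \<Omega> :: "(complex ^ 'n) set"
  assumes \<Omega>: "bounded_convex_domain \<Omega>" and C: "0 < C" and m: "0 < m"
    and mc: "\<And>z v. z \<in> \<Omega> \<Longrightarrow> v \<noteq> 0 \<Longrightarrow> bdry_dist_dir \<Omega> z v \<le> C * bdry_dist \<Omega> z powr (1 / m)"
    and xy: "x \<in> \<Omega>" "y \<in> \<Omega>"
  shows "dist x y \<le> 2 * C * (bdry_dist \<Omega> x * exp (2 * kobayashi_dist \<Omega> x y)) powr (1 / m) *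
           kobayashi_dist \<Omega> x y"
proof (rule le_isCont_limit[where f="\<lambda>l. 2 * C * (bdry_dist \<Omega> x * exp (2 * l)) powr (1 / m) * l"])
  show "isCont (\<lambda>l. 2 * C * (bdry_dist \<Omega> x * exp (2 * l)) powr (1 / m) * l) (kobayashi_dist \<Omega> x y)"
    using bdry_dist_pos[OF \<Omega> xy(1)] by (intro continuous_intros) auto
  fix l assume l: "kobayashi_dist \<Omega> x y < l"
  obtain \<gamma> where \<gamma>: "valid_path \<gamma>" "path_image \<gamma> \<subseteq> \<Omega>" "\<gamma> 0 = x" "\<gamma> 1 = y"
    "kobayashi_length \<Omega> \<gamma> \<le> ennreal l"
    using kobayashi_dist_path[OF \<Omega> xy l] .
  show "dist x y \<le> 2 * C * (bdry_dist \<Omega> x * exp (2 * l)) powr (1 / m) * l"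
    using dist_path_le[OF \<Omega> C m mc \<gamma>(1,2,5)] \<gamma>(3,4) l kobayashi_dist_nonneg[of \<Omega> x y] by simp
qed

section \<open>Euclidean length under an exponentially decaying speed bound\<close>

text \<open>Chains steps of length at most 1 by the triangle inequality. The restriction to short
  steps keeps the factor \<open>exp (k * (t - s))\<close> of the distance estimate bounded.\<close>

lemma dist_le_local_to_global:
  fixes \<sigma> :: "real \<Rightarrow> 'a::metric_space"
  assumes loc: "\<And>s t. a \<le> s \<Longrightarrow> s \<le> t \<Longrightarrow> t \<le> b \<Longrightarrow> t - s \<le> 1 \<Longrightarrow> dist (\<sigma> s) (\<sigma> t) \<le> F t - F s"
    and st: "a \<le> s" "s \<le> t" "t \<le> b"
  shows "dist (\<sigma> s) (\<sigma> t) \<le> F t - F s"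
proof -
  have "dist (\<sigma> s) (\<sigma> t) \<le> F t - F s" if "a \<le> s" "s \<le> t" "t \<le> b" "t - s \<le> real n" for n s t
    using that
  proof (induction n arbitrary: s)
    case 0
    then show ?case using loc[of s t] by simp
  next
    case (Suc n)
    define r where "r = min t (s + 1)"
    have "dist (\<sigma> s) (\<sigma> r) \<le> F r - F s"
      using Suc.prems by (intro loc) (auto simp: r_def)
    moreover have "dist (\<sigma> r) (\<sigma> t) \<le> F t - F r"
      using Suc.prems by (intro Suc.IH) (auto simp: r_def)
    ultimately show ?case
      using dist_triangle[of "\<sigma> s" "\<sigma> t" "\<sigma> r"] by linarith
  qed
  moreover obtain n where "t - s \<le> real n"
    using real_arch_simple by blast
  ultimately show ?thesis
    using st by blast
qed

lemma curve_length_le: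
  fixes \<sigma> :: "real \<Rightarrow> 'a::metric_space"
  assumes "\<And>s t. a \<le> s \<Longrightarrow> s \<le> t \<Longrightarrow> t \<le> b \<Longrightarrow> dist (\<sigma> s) (\<sigma> t) \<le> F t - F s"
  shows "curve_length a b \<sigma> \<le> ennreal (F b - F a)"
  unfolding curve_length_def
proof (rule SUP_least, clarify)
  fix k :: nat and p :: "nat \<Rightarrow> real"
  assume p: "a = p 0" "b = p k" "mono_on {0..k} p"
  have "(\<Sum>j<k. dist (\<sigma> (p j)) (\<sigma> (p (Suc j)))) \<le> (\<Sum>j<k. F (p (Suc j)) - F (p j))"
    using p(3) by (intro sum_mono assms) (auto simp: p(1,2) mono_on_def)
  also have "\<dots> = F (p k) - F (p 0)"
    by (rule sum_lessThan_telescope)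
  finally show "(\<Sum>j<k. ennreal (dist (\<sigma> (p j)) (\<sigma> (p (Suc j))))) \<le> ennreal (F (p k) - F (p 0))"
    by (simp add: ennreal_leI)
qed

lemma exp_diff_ge:
  fixes s t :: real
  shows "exp s * (t - s) \<le> exp t - exp s"
proof -
  have "exp s * (1 + (t - s)) \<le> exp s * exp (t - s)"
    using exp_ge_add_one_self[of "t - s"] by (intro mult_left_mono) auto
  then show ?thesis
    by (simp add: exp_diff distrib_left)
qed

text \<open>On short steps the distance is dominated by the increment of a primitive
  \<open>F\<close> of a multiple of \<open>exp (- k * \<bar>t - t0\<bar>)\<close>, and the total
  increase of \<open>F\<close> is finite.\<close>

lemma curve_length_exp_decay:
  fixes \<sigma> :: "real \<Rightarrow> 'a::metric_space"
  assumes k: "0 < k" and A: "0 \<le> A"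
    and loc: "\<And>s t. a \<le> s \<Longrightarrow> s \<le> t \<Longrightarrow> t \<le> b \<Longrightarrow>
      dist (\<sigma> s) (\<sigma> t) \<le> A * (exp (- k * \<bar>s - t0\<bar>) * exp (k * (t - s))) * (t - s)"
  shows "curve_length a b \<sigma> \<le> ennreal (2 * A * exp (2 * k) / k)"
proof -
  \<comment> \<open>One factor \<open>exp k\<close> bounds \<open>exp (k * (t - s))\<close> on unit
    steps; the other pays, to the right of \<open>t0\<close>, for moving the base point of the decay
    from \<open>s\<close> to \<open>t\<close>.\<close>
  define G where "G = A * exp (2 * k) / k"
  have G: "0 \<le> G" using A k by (simp add: G_def)
  \<comment> \<open>The primitive of \<open>k * G * exp (- k * \<bar>t - t0\<bar>)\<close> that
    tends to 0 at minus infinity; both branches equal \<open>G\<close> at \<open>t0\<close>. Its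
    range lies in \<open>[0, 2 * G]\<close>, so \<open>t0\<close> may lie outside
    \<open>[a, b]\<close>.\<close>
  define F where "F = (\<lambda>t. if t \<le> t0 then G * exp (k * (t - t0)) else 2 * G - G * exp (- (k * (t - t0))))"
  have F: "0 \<le> F t" "F t \<le> 2 * G" for t
  proof -
    have le: "G * exp u \<le> G" if "u \<le> 0" for u
      using that G mult_left_mono[of "exp u" 1 G] by simp
    show "0 \<le> F t"
    proof (cases "t \<le> t0")
      case True
      then show ?thesis using G by (simp add: F_def)
    next
      case False
      then have "0 \<le> k * (t - t0)" using k by simp
      then show ?thesis using G le[of "- (k * (t - t0))"] unfolding F_def if_not_P[OF False] by linarith
    qed
    show "F t \<le> 2 * G"
    proof (cases "t \<le> t0")
      case True
      then have "k * (t - t0) \<le> 0" using k by (intro mult_nonneg_nonpos) auto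
      then show ?thesis using G le[of "k * (t - t0)"] unfolding F_def if_P[OF True] by linarith
    next
      case False
      have "0 \<le> G * exp (- (k * (t - t0)))" using G by simp
      then show ?thesis unfolding F_def if_not_P[OF False] by linarith
    qed
  qed
  have up: "dist (\<sigma> s) (\<sigma> t) \<le> F t - F s"
    if st: "a \<le> s" "s \<le> t" "t \<le> b" "t - s \<le> 1" "t \<le> t0" for s t
  proof -
    have "exp (- k * \<bar>s - t0\<bar>) * exp (k * (t - s)) \<le> exp (2 * k) * exp (k * (s - t0))"
      unfolding exp_add[symmetric] exp_le_cancel_iff using st k mult_left_mono[OF st(4), of k]
      by (cases "s \<le> t0") (simp_all add: algebra_simps)
    then have "dist (\<sigma> s) (\<sigma> t) \<le> A * (exp (2 * k) * exp (k * (s - t0))) * (t - s)"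
      using st(2) A by (intro order_trans[OF loc[OF st(1-3)]] mult_right_mono mult_left_mono) auto
    also have "\<dots> = G * (exp (k * (s - t0)) * (k * (t - s)))"
      using k by (simp add: G_def)
    also have "\<dots> = G * (exp (k * (s - t0)) * (k * (t - t0) - k * (s - t0)))"
      by (simp add: right_diff_distrib[of k])
    also have "\<dots> \<le> G * (exp (k * (t - t0)) - exp (k * (s - t0)))"
      using G by (intro mult_left_mono exp_diff_ge)
    finally show ?thesis using st by (simp add: F_def right_diff_distrib[of G])
  qed
  have down: "dist (\<sigma> s) (\<sigma> t) \<le> F t - F s"
    if st: "a \<le> s" "s \<le> t" "t \<le> b" "t - s \<le> 1" "t0 \<le> s" for s t
  proof -
    have "exp (- k * \<bar>s - t0\<bar>) * exp (k * (t - s)) \<le> exp (2 * k) * exp (- (k * (t - t0)))"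
      unfolding exp_add[symmetric] exp_le_cancel_iff using st k mult_left_mono[OF st(4), of k]
      by (cases "s \<le> t0") (simp_all add: algebra_simps)
    then have "dist (\<sigma> s) (\<sigma> t) \<le> A * (exp (2 * k) * exp (- (k * (t - t0)))) * (t - s)"
      using st(2) A by (intro order_trans[OF loc[OF st(1-3)]] mult_right_mono mult_left_mono) auto
    also have "\<dots> = G * (exp (- (k * (t - t0))) * (k * (t - s)))"
      using k by (simp add: G_def)
    also have "\<dots> = G * (exp (- (k * (t - t0))) * (- (k * (s - t0)) - - (k * (t - t0))))"
      by (simp add: right_diff_distrib[of k])
    \<comment> \<open>The tangent is taken at the right end \<open>t\<close>, where the exponential
      is smaller; in \<open>up\<close> it was taken at \<open>s\<close>.\<close>
    also have "\<dots> \<le> G * (exp (- (k * (s - t0))) - exp (- (k * (t - t0))))"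
      using G by (intro mult_left_mono exp_diff_ge)
    finally show ?thesis using st by (cases "t \<le> t0"; cases "s \<le> t0") (simp_all add: F_def right_diff_distrib[of G])
  qed
  have "dist (\<sigma> s) (\<sigma> t) \<le> F t - F s"
    if st: "a \<le> s" "s \<le> t" "t \<le> b" "t - s \<le> 1" for s t
  proof -
    consider "t \<le> t0" | "t0 \<le> s" | "s \<le> t0" "t0 \<le> t" by linarith
    then show ?thesis
    proof cases
      case 1
      with st show ?thesis by (rule up)
    next
      case 2
      with st show ?thesis by (rule down)
    next
      case 3
      have "dist (\<sigma> s) (\<sigma> t0) \<le> F t0 - F s" "dist (\<sigma> t0) (\<sigma> t) \<le> F t - F t0"
        using up[of s t0] down[of t0 t] st 3 by simp_all
      then show ?thesis
        using dist_triangle[of "\<sigma> s" "\<sigma> t" "\<sigma> t0"] by linarith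
    qed
  qed
  then have "curve_length a b \<sigma> \<le> ennreal (F b - F a)"
    by (rule curve_length_le[OF dist_le_local_to_global[where a=a and b=b]])
  also have "\<dots> \<le> ennreal (2 * A * exp (2 * k) / k)"
    using F(1)[of a] F(2)[of b] by (intro ennreal_leI) (simp add: G_def)
  finally show ?thesis .
qed

section \<open>Boundary distance along a geodesic and the final estimate\<close>

text \<open>The two bounds on \<open>bdry_dist \<Omega> (\<sigma> s)\<close> coming from the end points cross at \<open>t0\<close>,
  where their common value is \<open>M\<close>.\<close>

lemma geodesic_bdry_dist_le:
  fixes \<Omega> :: "(complex ^ 'n) set"
  assumes \<Omega>: "bounded_convex_domain \<Omega>" and xy: "x \<in> \<Omega>" "y \<in> \<Omega>"
    and \<sigma>: "kobayashi_geodesic \<Omega> x y \<sigma>" and s: "s \<in> {0..kobayashi_dist \<Omega> x y}"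
  defines "M \<equiv> sqrt (bdry_dist \<Omega> x * bdry_dist \<Omega> y) * exp (kobayashi_dist \<Omega> x y)"
    and "t0 \<equiv> kobayashi_dist \<Omega> x y / 2 + ln (bdry_dist \<Omega> y / bdry_dist \<Omega> x) / 4"
  shows "bdry_dist \<Omega> (\<sigma> s) \<le> M * exp (- 2 * \<bar>s - t0\<bar>)"
proof -
  let ?D = "kobayashi_dist \<Omega> x y"
  \<comment> \<open>In logarithmic coordinates the bounds from the two end points become linear in
    \<open>s\<close>, with slopes 2 and -2.\<close>
  define p q where "p = ln (bdry_dist \<Omega> x)" and "q = ln (bdry_dist \<Omega> y)"
  have pos: "0 < bdry_dist \<Omega> x" "0 < bdry_dist \<Omega> y"
    using bdry_dist_pos[OF \<Omega>] xy by auto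
  have ep: "bdry_dist \<Omega> x = exp p" and eq: "bdry_dist \<Omega> y = exp q"
    using pos by (auto simp: p_def q_def)
  have "sqrt (exp p * exp q) = exp ((p + q) / 2)"
    by (rule real_sqrt_unique) (auto simp: power2_eq_square simp flip: exp_add)
  then have M: "M = exp ((p + q) / 2 + ?D)"
    by (simp add: M_def ep eq exp_add)
  have t0: "t0 = ?D / 2 + (q - p) / 4"
    unfolding t0_def using pos by (simp add: ln_div p_def q_def)
  have D: "0 \<le> ?D" by (rule kobayashi_dist_nonneg)
  have iso: "kobayashi_dist \<Omega> (\<sigma> r) (\<sigma> t) = \<bar>r - t\<bar>" if "r \<in> {0..?D}" "t \<in> {0..?D}" for r t
    using \<sigma> that by (auto simp: kobayashi_geodesic_def)
  have ends: "\<sigma> 0 = x" "\<sigma> ?D = y" and \<sigma>s: "\<sigma> s \<in> \<Omega>"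
    using \<sigma> s by (auto simp: kobayashi_geodesic_def)
  have "bdry_dist \<Omega> (\<sigma> s) \<le> exp (p + 2 * s)"
    using bdry_dist_le_exp[OF \<Omega> xy(1) \<sigma>s] iso[of 0 s] s D by (simp add: ends ep exp_add)
  moreover have "bdry_dist \<Omega> (\<sigma> s) \<le> exp (q + 2 * (?D - s))"
    using bdry_dist_le_exp[OF \<Omega> xy(2) \<sigma>s] iso[of ?D s] s D by (simp add: ends eq exp_add)
  ultimately have "bdry_dist \<Omega> (\<sigma> s) \<le> exp (min (p + 2 * s) (q + 2 * (?D - s)))"
    by (simp add: min_def)
  \<comment> \<open>The minimum of two numbers is their mean minus half the absolute value of their
    difference; \<open>t0\<close> is where the two lines cross.\<close>
  also have "min (p + 2 * s) (q + 2 * (?D - s)) = (p + q) / 2 + ?D + - 2 * \<bar>s - t0\<bar>"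
    by (simp add: t0 min_def abs_if field_simps)
  finally show ?thesis
    by (simp only: M exp_add)
qed

theorem corollary1p4:
  fixes \<Omega> :: "(complex ^ 'n) set" and m :: real
  assumes "CARD('n) \<ge> 2"
    and "m_convex m \<Omega>"
  shows "\<exists>C>0. \<forall>x\<in>\<Omega>. \<forall>y\<in>\<Omega>. \<forall>\<sigma>. kobayashi_geodesic \<Omega> x y \<sigma> \<longrightarrow>
           geodesic_length \<Omega> x y \<sigma> < \<infinity> \<and>
           kobayashi_dist \<Omega> x y \<ge>
             ln ((enn2real (geodesic_length \<Omega> x y \<sigma>) powr m + max (bdry_dist \<Omega> x) (bdry_dist \<Omega> y))
                 / sqrt (bdry_dist \<Omega> x * bdry_dist \<Omega> y)) - C"
proof -
  have \<Omega>: "bounded_convex_domain \<Omega>" and m: "0 < m"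
    using assms(2) by (auto simp: m_convex_def)
  obtain C where C: "0 < C"
    "\<And>z v. z \<in> \<Omega> \<Longrightarrow> v \<noteq> 0 \<Longrightarrow> bdry_dist_dir \<Omega> z v \<le> C * bdry_dist \<Omega> z powr (1 / m)"
    using assms(2) by (auto simp: m_convex_def)
  \<comment> \<open>The decay rate of the speed: \<open>exp (2 * u) powr (1 / m)\<close> equals
    \<open>exp (k * u)\<close>.\<close>
  define k where "k = 2 / m"
  have k: "0 < k" using m by (simp add: k_def)
  \<comment> \<open>The constant of \<open>curve_length_exp_decay\<close> for
    \<open>A = 2 * C * M powr (1 / m)\<close>, with the factor depending on \<open>x\<close> and
    \<open>y\<close> removed.\<close>
  define c where "c = 4 * C * exp (2 * k) / k"
  have c: "0 < c" using C k by (simp add: c_def)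
  show ?thesis
  \<comment> \<open>The term \<open>c powr m\<close> comes from the length and the 1 from the
    maximum of the boundary distances; each is measured against \<open>M\<close>.\<close>
  proof (intro exI[of _ "ln (c powr m + 1)"] conjI ballI allI impI)
    show "0 < ln (c powr m + 1)" using c by (intro ln_gt_zero) simp
    fix x y \<sigma>
    assume xy: "x \<in> \<Omega>" "y \<in> \<Omega>" and \<sigma>: "kobayashi_geodesic \<Omega> x y \<sigma>"
    let ?D = "kobayashi_dist \<Omega> x y" and ?L = "geodesic_length \<Omega> x y \<sigma>"
    define R where "R = sqrt (bdry_dist \<Omega> x * bdry_dist \<Omega> y)"
    define M where "M = R * exp ?D"
    define t0 where "t0 = ?D / 2 + ln (bdry_dist \<Omega> y / bdry_dist \<Omega> x) / 4"
    have pos: "0 < bdry_dist \<Omega> x" "0 < bdry_dist \<Omega> y"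
      using bdry_dist_pos[OF \<Omega>] xy by auto
    then have R: "0 < R" by (simp add: R_def)
    then have M: "0 < M" by (simp add: M_def)
    have D: "0 \<le> ?D" by (rule kobayashi_dist_nonneg)
    have \<delta>: "bdry_dist \<Omega> (\<sigma> s) \<le> M * exp (- 2 * \<bar>s - t0\<bar>)" if "s \<in> {0..?D}" for s
      using geodesic_bdry_dist_le[OF \<Omega> xy \<sigma> that] by (simp add: M_def R_def t0_def)
    have in\<Omega>: "\<sigma> s \<in> \<Omega>" if "s \<in> {0..?D}" for s
      using \<sigma> that by (auto simp: kobayashi_geodesic_def)
    have "curve_length 0 ?D \<sigma> \<le> ennreal (2 * (2 * C * M powr (1 / m)) * exp (2 * k) / k)"
    proof (rule curve_length_exp_decay[OF k])
      fix s t assume st: "0 \<le> s" "s \<le> t" "t \<le> ?D"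
      have "kobayashi_dist \<Omega> (\<sigma> s) (\<sigma> t) = t - s"
        using \<sigma> st by (auto simp: kobayashi_geodesic_def)
      then have "dist (\<sigma> s) (\<sigma> t)
          \<le> 2 * C * (bdry_dist \<Omega> (\<sigma> s) * exp (2 * (t - s))) powr (1 / m) * (t - s)"
        using dist_le_kobayashi_dist[OF \<Omega> C(1) m C(2), of "\<sigma> s" "\<sigma> t"] in\<Omega> st by simp
      also have "\<dots> \<le> 2 * C * (M * exp (- 2 * \<bar>s - t0\<bar>) * exp (2 * (t - s))) powr (1 / m) * (t - s)"
        using C m st \<delta>[of s] bdry_dist_pos[OF \<Omega> in\<Omega>[of s]]
        by (intro mult_right_mono mult_left_mono powr_mono2) auto
      also have "\<dots> = 2 * C * M powr (1 / m) * (exp (- k * \<bar>s - t0\<bar>) * exp (k * (t - s))) * (t - s)"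
        using M by (simp add: powr_mult exp_powr_real k_def)
      finally show "dist (\<sigma> s) (\<sigma> t)
        \<le> 2 * C * M powr (1 / m) * (exp (- k * \<bar>s - t0\<bar>) * exp (k * (t - s))) * (t - s)" .
    qed (use C in auto)
    then have L: "?L \<le> ennreal (c * M powr (1 / m))"
      by (simp add: geodesic_length_def c_def mult_ac)
    then show "?L < \<infinity>"
      by (simp add: order_le_less_trans)
    have "enn2real ?L \<le> c * M powr (1 / m)"
      using L c by (intro enn2real_leI) auto
    then have "enn2real ?L powr m \<le> (c * M powr (1 / m)) powr m"
      using m by (intro powr_mono2) auto
    also have "\<dots> = c powr m * M"
      using c M m by (simp add: powr_mult powr_powr)
    finally have Lm: "enn2real ?L powr m \<le> c powr m * M" .
    have leM: "bdry_dist \<Omega> (\<sigma> s) \<le> M" if "s \<in> {0..?D}" for s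
    proof -
      have "M * exp (- 2 * \<bar>s - t0\<bar>) \<le> M * 1"
        using M by (intro mult_left_mono) auto
      then show ?thesis using \<delta>[OF that] by linarith
    qed
    have "max (bdry_dist \<Omega> x) (bdry_dist \<Omega> y) \<le> M"
      using leM[of 0] leM[of ?D] D \<sigma> by (auto simp: kobayashi_geodesic_def)
    with Lm have "enn2real ?L powr m + max (bdry_dist \<Omega> x) (bdry_dist \<Omega> y) \<le> (c powr m + 1) * M"
      unfolding distrib_right by linarith
    \<comment> \<open>Dividing by \<open>R\<close> turns \<open>M\<close> into
      \<open>exp ?D\<close>, so taking logarithms yields the distance plus a constant.\<close>
    then have "(enn2real ?L powr m + max (bdry_dist \<Omega> x) (bdry_dist \<Omega> y)) / R \<le> (c powr m + 1) * exp ?D"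
      using R by (simp add: M_def divide_le_eq mult_ac)
    moreover have "0 < (enn2real ?L powr m + max (bdry_dist \<Omega> x) (bdry_dist \<Omega> y)) / R"
      using R pos by (intro divide_pos_pos add_nonneg_pos) auto
    ultimately have "ln ((enn2real ?L powr m + max (bdry_dist \<Omega> x) (bdry_dist \<Omega> y)) / R)
        \<le> ln ((c powr m + 1) * exp ?D)"
      by (subst ln_le_cancel_iff) (auto intro: order_less_le_trans)
    also have "\<dots> = ln (c powr m + 1) + ?D"
      using powr_ge_zero[of c m] by (subst ln_mult) (auto simp del: powr_ge_zero)
    finally show "?D \<ge> ln ((enn2real ?L powr m + max (bdry_dist \<Omega> x) (bdry_dist \<Omega> y))
                 / sqrt (bdry_dist \<Omega> x * bdry_dist \<Omega> y)) - ln (c powr m + 1)"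
      by (simp add: R_def)
  qed
qed

end
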